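(* Let $T$ be a finite tree and let $m$ be a positive integer. Then $\chi'_g(T;m,1)\le \Delta(T)+2$, where $\Delta(T)$ is the maximum degree of $T$.
   Context: The $(m,1)$-edge coloring game on a finite simple graph $G$ with a set of colors $X$ is played alternately by two players, Maker and Breaker, with Maker playing first. On each turn Maker makes $m$ moves and Breaker makes one move; a move consists of coloring one uncolored edge of $G$ with a color from $X$ so that adjacent edges (edges sharing an endpoint) always receive distinct colors. Maker wins if eventually every edge is colored; Breaker wins if at some point the player who is to move cannot color any edge. The $(m,1)$-game chromatic index $\chi'_g(G;m,1)$ is the smallest nonnegative integer $k$ such that Maker has a winning strategy when $|X|=k$. *)

theory Defs
  imports Main
begin

section \<open>Finite simple graphs and trees\<close>

text \<open>A graph is given by its vertex set and its set of edges, each edge being the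
  two-element set of its endpoints.\<close>

definition finite_simple_graph :: "'a set \<Rightarrow> 'a set set \<Rightarrow> bool" where
  "finite_simple_graph V E \<longleftrightarrow> finite V \<and> (\<forall>e\<in>E. e \<subseteq> V \<and> card e = 2)"

definition degree :: "'a set set \<Rightarrow> 'a \<Rightarrow> nat" where
  "degree E v = card {e\<in>E. v \<in> e}"

definition max_degree :: "'a set \<Rightarrow> 'a set set \<Rightarrow> nat" where
  "max_degree V E = Max (degree E ` V)"

definition connected_graph :: "'a set \<Rightarrow> 'a set set \<Rightarrow> bool" where
  "connected_graph V E \<longleftrightarrow> (\<forall>u\<in>V. \<forall>v\<in>V. (u, v) \<in> {(x, y). {x, y} \<in> E}\<^sup>*)"

text \<open>A cycle is listed by its vertices without repeating the first one, so the case
  \<open>i = length vs - 1\<close> is the closing edge.\<close>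

definition is_cycle :: "'a set set \<Rightarrow> 'a list \<Rightarrow> bool" where
  "is_cycle E vs \<longleftrightarrow> 3 \<le> length vs \<and> distinct vs \<and>
     (\<forall>i<length vs. {vs ! i, vs ! (Suc i mod length vs)} \<in> E)"

definition finite_tree :: "'a set \<Rightarrow> 'a set set \<Rightarrow> bool" where
  "finite_tree V E \<longleftrightarrow> finite_simple_graph V E \<and> V \<noteq> {} \<and>
     connected_graph V E \<and> (\<nexists>vs. is_cycle E vs)"


section \<open>The edge coloring game\<close>

text \<open>A position of the game is recorded by its history, the list of all moves made so
  far in chronological order; the move \<open>(e, x)\<close> colors the edge \<open>e\<close> with \<open>x\<close>.\<close>

type_synonym ('a, 'c) move = "'a set \<times> 'c"

definition legal_move ::
  "'a set set \<Rightarrow> 'c set \<Rightarrow> ('a, 'c) move list \<Rightarrow> ('a, 'c) move \<Rightarrow> bool" where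
  "legal_move E X h mv \<longleftrightarrow>
     fst mv \<in> E \<and> snd mv \<in> X \<and> fst mv \<notin> fst ` set h \<and>
     (\<forall>(f, y)\<in>set h. fst mv \<inter> f \<noteq> {} \<longrightarrow> snd mv \<noteq> y)"

definition is_play :: "'a set set \<Rightarrow> 'c set \<Rightarrow> ('a, 'c) move list \<Rightarrow> bool" where
  "is_play E X h \<longleftrightarrow> (\<forall>i<length h. legal_move E X (take i h) (h ! i))"

definition all_colored :: "'a set set \<Rightarrow> ('a, 'c) move list \<Rightarrow> bool" where
  "all_colored E h \<longleftrightarrow> E \<subseteq> fst ` set h"

text \<open>A round consists of \<open>m\<close> moves of Maker followed by one move of Breaker. The
  next move after \<open>n\<close> moves belongs to Maker exactly in the following case.\<close>

definition maker_to_move :: "nat \<Rightarrow> nat \<Rightarrow> bool" where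
  "maker_to_move m n \<longleftrightarrow> n mod (m + 1) < m"

text \<open>Every edge may be colored by either player, so the available moves, and hence being
  stuck, do not depend on whose move it is; a player may also get stuck in the middle
  of a turn.\<close>

definition breaker_has_won :: "'a set set \<Rightarrow> 'c set \<Rightarrow> ('a, 'c) move list \<Rightarrow> bool" where
  "breaker_has_won E X h \<longleftrightarrow> \<not> all_colored E h \<and> (\<nexists>mv. legal_move E X h mv)"

definition maker_strategy ::
  "'a set set \<Rightarrow> 'c set \<Rightarrow> nat \<Rightarrow> (('a, 'c) move list \<Rightarrow> ('a, 'c) move) \<Rightarrow> bool" where
  "maker_strategy E X m \<sigma> \<longleftrightarrow>
     (\<forall>h. is_play E X h \<and> maker_to_move m (length h) \<and> (\<exists>mv. legal_move E X h mv)
        \<longrightarrow> legal_move E X h (\<sigma> h))"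

definition follows ::
  "nat \<Rightarrow> (('a, 'c) move list \<Rightarrow> ('a, 'c) move) \<Rightarrow> ('a, 'c) move list \<Rightarrow> bool" where
  "follows m \<sigma> h \<longleftrightarrow> (\<forall>i<length h. maker_to_move m i \<longrightarrow> h ! i = \<sigma> (take i h))"

text \<open>As no edge is colored twice, every play on a finite graph ends, either with all edges
  colored or in a win for Breaker. Maker therefore wins every play following \<open>\<sigma>\<close> iff
  no such play reaches a win for Breaker.\<close>

definition maker_winning_strategy ::
  "'a set set \<Rightarrow> 'c set \<Rightarrow> nat \<Rightarrow> (('a, 'c) move list \<Rightarrow> ('a, 'c) move) \<Rightarrow> bool" where
  "maker_winning_strategy E X m \<sigma> \<longleftrightarrow> maker_strategy E X m \<sigma> \<and>
     (\<forall>h. is_play E X h \<and> follows m \<sigma> h \<longrightarrow> \<not> breaker_has_won E X h)"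

text \<open>Only the number of colors matters, so \<open>{..<k}\<close> serves as the set of \<open>k\<close> colors.\<close>

definition game_chromatic_index :: "'a set set \<Rightarrow> nat \<Rightarrow> nat" where
  "game_chromatic_index E m =
     (LEAST k. \<exists>\<sigma>. maker_winning_strategy E {..<k::nat} m \<sigma>)"


section \<open>The game chromatic index is well defined\<close>

lemma is_play_distinct: "is_play E X h \<Longrightarrow> distinct (map fst h)"
proof (induction h rule: rev_induct)
  case (snoc mv h)
  have "legal_move E X (take i h) (h ! i)" if "i < length h" for i
    using snoc.prems that by (auto simp: is_play_def nth_append dest!: spec[of _ i])
  moreover have "legal_move E X h mv"
    using snoc.prems by (auto simp: is_play_def dest!: spec[of _ "length h"])
  ultimately show ?case
    using snoc.IH by (auto simp: is_play_def legal_move_def)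
qed simp

lemma is_play_edges: "is_play E X h \<Longrightarrow> fst ` set h \<subseteq> E"
  by (auto simp: is_play_def legal_move_def in_set_conv_nth) (metis fst_conv)

lemma ex_maker_winning_strategy:
  assumes "finite E"
  shows "\<exists>k \<sigma>. maker_winning_strategy E {..<k::nat} m \<sigma>"
proof -
  let ?X = "{..<card E}"
  have "\<not> breaker_has_won E ?X h" if h: "is_play E ?X h" for h
  proof
    assume won: "breaker_has_won E ?X h"
    then obtain e where e: "e \<in> E" "e \<notin> fst ` set h"
      by (auto simp: breaker_has_won_def all_colored_def)
    have "card (snd ` set h) \<le> length h"
      by (metis card_length length_map set_map)
    also have "\<dots> = card (fst ` set h)"
      by (metis distinct_card h is_play_distinct length_map set_map)
    also have "\<dots> < card E"
      using e is_play_edges[OF h] assms by (metis psubsetI psubset_card_mono)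
    finally have "\<not> ?X \<subseteq> snd ` set h"
      by (metis List.finite_set card_lessThan card_mono finite_imageI not_le)
    then obtain x where "x \<in> ?X" "x \<notin> snd ` set h" by blast
    with e have "legal_move E ?X h (e, x)"
      by (force simp: legal_move_def)
    with won show False by (auto simp: breaker_has_won_def)
  qed
  then have "maker_winning_strategy E ?X m (\<lambda>h. SOME mv. legal_move E ?X h mv)"
    by (auto simp: maker_winning_strategy_def maker_strategy_def intro: someI)
  then show ?thesis by blast
qed

end

theory Submission
  imports Defs
begin

text \<open>Root the tree. The descendants of an edge are the edges below it, and an edge is called
  alive if it or one of its descendants is colored. Maker keeps the invariant that, whenever
  Breaker is to move, every uncolored edge has at most one alive child. A move of Breaker makes
  alive a path that ends below the first already alive edge; only that edge can then have two
  alive children, and Maker colors it, which makes no further edge alive. If there is no such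
  edge, Maker colors an uncolored edge all of whose ancestors are colored. Hence an uncolored
  edge always has at most two colored children and at most \<open>\<Delta> - 1\<close> further colored neighbours,
  so that one of \<open>\<Delta> + 2\<close> colors is free for it.\<close>

section \<open>Leaves of acyclic graphs\<close>

definition is_path :: "'a set set \<Rightarrow> 'a list \<Rightarrow> bool" where
  "is_path E vs \<longleftrightarrow> distinct vs \<and> (\<forall>i. Suc i < length vs \<longrightarrow> {vs ! i, vs ! Suc i} \<in> E)"

lemma is_path_Cons:
  assumes "is_path E (v # vs)" "w \<notin> set (v # vs)" "{w, v} \<in> E"
  shows "is_path E (w # v # vs)"
  unfolding is_path_def
proof (intro conjI allI impI)
  show "distinct (w # v # vs)"
    using assms by (auto simp: is_path_def)
  fix i assume "Suc i < length (w # v # vs)"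
  then show "{(w # v # vs) ! i, (w # v # vs) ! Suc i} \<in> E"
    using assms by (cases i) (auto simp: is_path_def)
qed

lemma is_path_back_edge_cycle:
  assumes path: "is_path E vs" and i: "2 \<le> i" "i < length vs" and closing: "{vs ! 0, vs ! i} \<in> E"
  shows "is_cycle E (take (Suc i) vs)"
  unfolding is_cycle_def
proof (intro conjI allI impI)
  have len: "length (take (Suc i) vs) = Suc i"
    using i by simp
  then show "3 \<le> length (take (Suc i) vs)"
    using i by linarith
  show "distinct (take (Suc i) vs)"
    using path by (simp add: is_path_def)
  fix j assume "j < length (take (Suc i) vs)"
  \<comment> \<open>For \<open>j = i\<close> the successor index wraps around to 0, which is the
    closing edge.\<close>
  with len have "j < i \<or> j = i" by linarith
  then show "{take (Suc i) vs ! j, take (Suc i) vs ! (Suc j mod length (take (Suc i) vs))} \<in> E"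
    unfolding len using path i closing by (auto simp: is_path_def insert_commute)
qed

text \<open>The first vertex of a longest path is the leaf: a neighbour off the path would extend
  it, and one at index 2 or more would close a cycle, so only the second vertex remains.\<close>

lemma acyclic_ex_leaf:
  assumes fin: "finite E" and card2: "\<And>e. e \<in> E \<Longrightarrow> card e = 2"
    and acyclic: "\<nexists>vs. is_cycle E vs" and "E \<noteq> {}"
  shows "\<exists>e\<in>E. \<exists>v\<in>e. \<forall>f\<in>E. v \<in> f \<longrightarrow> f = e"
proof -
  have finU: "finite (\<Union>E)"
    using fin card2 by (metis card.infinite finite_Union zero_neq_numeral)
  \<comment> \<open>At least two vertices, so that each vertex of the path lies on an edge and
    \<open>card (\<Union>E)\<close> bounds the length.\<close>
  define P where "P vs \<longleftrightarrow> is_path E vs \<and> 2 \<le> length vs" for vs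
  have bound: "length vs \<le> card (\<Union>E)" if "P vs" for vs
  proof -
    have "vs ! i \<in> \<Union>E" if "i < length vs" for i
    proof (cases i)
      case 0
      with \<open>P vs\<close> have "{vs ! i, vs ! Suc i} \<in> E" by (simp add: P_def is_path_def)
      then show ?thesis by blast
    next
      case (Suc j)
      with \<open>P vs\<close> that have "{vs ! j, vs ! i} \<in> E" by (simp add: P_def is_path_def)
      then show ?thesis by blast
    qed
    then have "set vs \<subseteq> \<Union>E"
      by (metis in_set_conv_nth subsetI)
    then have "card (set vs) \<le> card (\<Union>E)"
      by (rule card_mono[OF finU])
    then show ?thesis
      using that by (simp add: P_def is_path_def distinct_card)
  qed
  obtain e where e: "e \<in> E" using \<open>E \<noteq> {}\<close> by blast
  then obtain x y where xy: "e = {x, y}" "x \<noteq> y"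
    using card2 by (meson card_2_iff)
  then have "P [x, y]"
    using e by (simp add: P_def is_path_def)
  then obtain vs where vs: "P vs" and longest: "\<And>ws. P ws \<Longrightarrow> length ws \<le> length vs"
    using ex_has_greatest_nat[of P "[x, y]" length "Suc (card (\<Union>E))"] bound
    by (meson le_imp_less_Suc)
  have "2 \<le> length vs"
    using vs by (simp add: P_def)
  then obtain v w us where vs_eq: "vs = v # w # us"
    by (metis One_nat_def Suc_1 Suc_le_length_iff)
  have edge: "{v, w} \<in> E"
    using vs by (auto simp: P_def is_path_def vs_eq dest: spec[of _ 0])
  have "f = {v, w}" if f: "f \<in> E" "v \<in> f" for f
  proof -
    obtain z where z: "f = {v, z}" "z \<noteq> v"
      using f card2 by (metis card_2_iff insert_commute insertE singletonD)
    have "z \<in> set vs"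
    proof (rule ccontr)
      assume "z \<notin> set vs"
      moreover have "{z, v} \<in> E"
        using f z by (simp add: insert_commute)
      ultimately have "P (z # vs)"
        using vs is_path_Cons[of E v "w # us" z] by (simp add: P_def vs_eq)
      then show False
        using longest[of "z # vs"] by simp
    qed
    then obtain i where i: "i < length vs" "vs ! i = z"
      by (metis in_set_conv_nth)
    have "\<not> 2 \<le> i"
    proof
      assume "2 \<le> i"
      moreover have "{vs ! 0, vs ! i} \<in> E"
        using f z i by (simp add: vs_eq)
      ultimately show False
        using is_path_back_edge_cycle[of E vs i] vs i acyclic unfolding P_def by blast
    qed
    then have "i = 0 \<or> i = 1" by linarith
    then have "z = w"
      using i z by (auto simp: vs_eq)
    with z show ?thesis by simp
  qed
  with edge show ?thesis by blast
qed

section \<open>Rooted forests of edges\<close>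

text \<open>Listing the edges in the reverse order of a successive removal of leaves, \<open>low e\<close> is the
  leaf removed together with \<open>e\<close>, that is, the endpoint of \<open>e\<close> farther from the root.\<close>

locale ranked_edges =
  fixes E :: "'a set set" and low :: "'a set \<Rightarrow> 'a" and rank :: "'a set \<Rightarrow> nat"
  assumes finite_E: "finite E"
    and card_edge: "e \<in> E \<Longrightarrow> card e = 2"
    and low_in: "e \<in> E \<Longrightarrow> low e \<in> e"
    and inj_rank: "inj_on rank E"
    and low_notin: "e \<in> E \<Longrightarrow> f \<in> E \<Longrightarrow> rank e < rank f \<Longrightarrow> low f \<notin> e"

text \<open>Remove an edge at a leaf, rank the rest by induction, and put the removed edge on top
  with the leaf as its \<open>low\<close>. The leaf lies on no other edge, which is what
  \<open>low_notin\<close> demands of the new edge.\<close>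

lemma acyclic_ex_ranking:
  assumes "finite E" "\<And>e. e \<in> E \<Longrightarrow> card e = 2" "\<nexists>vs. is_cycle E vs"
  shows "\<exists>low rank. ranked_edges E low rank"
  using assms
proof (induction "card E" arbitrary: E)
  case 0
  then have "ranked_edges E (\<lambda>e. SOME v. v \<in> e) (\<lambda>_. 0)"
    by (simp add: ranked_edges_def)
  then show ?case by blast
next
  case (Suc n)
  then have "E \<noteq> {}" by auto
  then obtain e v where e: "e \<in> E" "v \<in> e" and leaf: "\<And>f. f \<in> E \<Longrightarrow> v \<in> f \<Longrightarrow> f = e"
    using acyclic_ex_leaf[OF Suc.prems] by blast
  have "\<nexists>vs. is_cycle (E - {e}) vs"
    using Suc.prems(3) by (auto simp: is_cycle_def)
  then obtain low rank where "ranked_edges (E - {e}) low rank"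
    using Suc.hyps(1)[of "E - {e}"] Suc.hyps(2) Suc.prems(1,2) e
    by (metis DiffD1 card_Diff_singleton diff_Suc_1 finite_Diff)
  then interpret R: ranked_edges "E - {e}" low rank .
  \<comment> \<open>If \<open>e\<close> is the only edge, \<open>Max\<close> of the empty set is
    unspecified, but then there is no other rank to exceed.\<close>
  define r where "r = Suc (Max (rank ` (E - {e})))"
  have r: "rank f < r" if "f \<in> E" "f \<noteq> e" for f
    using that R.finite_E by (simp add: r_def less_Suc_eq_le)
  define low' where "low' = low(e := v)"
  define rank' where "rank' = rank(e := r)"
  have "ranked_edges E low' rank'"
  proof
    show "inj_on rank' E"
      unfolding rank'_def using R.inj_rank r by (fastforce simp: inj_on_def)
    show "low' f \<in> f" if "f \<in> E" for f
      using that R.low_in[of f] e by (simp add: low'_def)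
    show "low' g \<notin> f" if fg: "f \<in> E" "g \<in> E" "rank' f < rank' g" for f g
    proof (cases "g = e")
      case True
      with fg have "f \<noteq> e" by auto
      with True show ?thesis
        using leaf fg by (auto simp: low'_def)
    next
      case False
      then have "f \<noteq> e"
        using fg r[of g] by (auto simp: rank'_def)
      with False show ?thesis
        using fg R.low_notin[of f g] by (simp add: low'_def rank'_def)
    qed
  qed (fact Suc.prems)+
  then show ?case by blast
qed

context ranked_edges
begin

text \<open>Pairs run from parent to child, away from the root, so \<open>child\<^sup>*\<close>
  relates ancestors to descendants, reflexively.\<close>

definition child :: "('a set \<times> 'a set) set" where
  "child = {(e, f). e \<in> E \<and> f \<in> E \<and> f \<noteq> e \<and> low e \<in> f}"

lemma child_rank_less:
  assumes "(e, f) \<in> child"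
  shows "rank e < rank f"
proof -
  have ef: "e \<in> E" "f \<in> E" "f \<noteq> e" "low e \<in> f"
    using assms unfolding child_def by auto
  then have "\<not> rank f < rank e"
    using low_notin by blast
  moreover have "rank e \<noteq> rank f"
    using inj_onD[OF inj_rank _ ef(1,2)] ef(3) by metis
  ultimately show ?thesis by linarith
qed

lemma descendant_rank_le: "(e, f) \<in> child\<^sup>* \<Longrightarrow> rank e \<le> rank f"
  by (induction rule: rtrancl_induct) (auto dest: child_rank_less)

text \<open>Both \<open>e\<close> and \<open>f\<close> rank below \<open>g\<close>, so neither
  contains \<open>low g\<close>, and \<open>low e\<close>, \<open>low f\<close> are both the other
  endpoint of \<open>g\<close>. Edges with a common \<open>low\<close> coincide, since the one of
  greater rank would have its \<open>low\<close> on the other.\<close>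

lemma parent_unique:
  assumes "(e, g) \<in> child" "(f, g) \<in> child"
  shows "e = f"
proof -
  have E: "e \<in> E" "f \<in> E" "g \<in> E" and low: "low e \<in> g" "low f \<in> g"
    using assms by (auto simp: child_def)
  have "low g \<notin> e" "low g \<notin> f"
    using assms E low_notin child_rank_less by blast+
  then have "low e \<noteq> low g" "low f \<noteq> low g"
    using E low_in by metis+
  moreover have "low g \<in> g" "card g = 2"
    using E low_in card_edge by auto
  ultimately have "low e = low f"
    using low by (auto simp: card_2_iff)
  then have "\<not> rank e < rank f" "\<not> rank f < rank e"
    using low_notin low_in E by metis+
  then show ?thesis
    using E inj_rank by (metis inj_onD linorder_neqE_nat)
qed

text \<open>Parents are unique, so the ancestors of \<open>g\<close> form a chain.\<close>

lemma ancestors_comparable: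
  assumes "(e, g) \<in> child\<^sup>*" "(f, g) \<in> child\<^sup>*"
  shows "(e, f) \<in> child\<^sup>* \<or> (f, e) \<in> child\<^sup>*"
proof -
  have "single_valued (child\<inverse>)"
    using parent_unique by (auto simp: single_valued_def)
  from single_valued_confluent[OF this, of g e f] show ?thesis
    using assms by (auto simp: rtrancl_converse)
qed

text \<open>The two children are comparable as ancestors of \<open>g\<close>. If one were a proper
  ancestor of the other, it would also be an ancestor of the common parent \<open>e\<close>, against
  the ranks.\<close>

lemma child_towards_unique:
  assumes "(e, f) \<in> child" "(e, f') \<in> child" "(f, g) \<in> child\<^sup>*" "(f', g) \<in> child\<^sup>*"
  shows "f = f'"
proof -
  have aux: "a = b" if ab: "(e, a) \<in> child" "(e, b) \<in> child" "(a, b) \<in> child\<^sup>*" for a b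
    using ab(3)
  proof (cases rule: rtranclE)
    case (step c)
    then have "(a, e) \<in> child\<^sup>*"
      using ab parent_unique by blast
    then show ?thesis
      using ab child_rank_less descendant_rank_le by (meson not_le)
  qed
  show ?thesis
    using ancestors_comparable[OF assms(3,4)] aux assms by metis
qed

section \<open>Alive children\<close>

definition alive :: "'a set set \<Rightarrow> 'a set set" where
  "alive C = {e. \<exists>g\<in>C. (e, g) \<in> child\<^sup>*}"

definition alive_children :: "'a set set \<Rightarrow> 'a set \<Rightarrow> 'a set set" where
  "alive_children C e = {f \<in> alive C. (e, f) \<in> child}"

definition stable :: "'a set set \<Rightarrow> bool" where
  "stable C \<longleftrightarrow> (\<forall>e\<in>E - C. card (alive_children C e) \<le> 1)"

text \<open>The invariant at every position when Maker follows the strategy: the bound 2 leaves a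
  free color, and the second clause offers an edge whose coloring makes the position
  \<open>stable\<close>.\<close>

definition repairable :: "'a set set \<Rightarrow> bool" where
  "repairable C \<longleftrightarrow> (\<forall>e\<in>E - C. card (alive_children C e) \<le> 2) \<and>
     (E \<subseteq> C \<or> (\<exists>e\<in>E - C. stable (insert e C)))"

lemma finite_alive_children [simp]: "finite (alive_children C e)"
  by (rule finite_subset[OF _ finite_E]) (auto simp: alive_children_def child_def)

lemma alive_insert: "alive (insert g C) = {e. (e, g) \<in> child\<^sup>*} \<union> alive C"
  by (auto simp: alive_def)

lemma alive_ancestor: "(e, f) \<in> child\<^sup>* \<Longrightarrow> f \<in> alive C \<Longrightarrow> e \<in> alive C"
  by (auto simp: alive_def intro: rtrancl_trans)

lemma alive_insert_alive: "e \<in> alive C \<Longrightarrow> alive (insert e C) = alive C"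
  by (auto simp: alive_insert intro: alive_ancestor)

lemma stable_empty: "stable {}"
  by (simp add: stable_def alive_children_def alive_def)

text \<open>Covers the positions where nothing needs repair, such as the start of the game and
  Maker's further moves within a turn.\<close>

lemma stable_imp_repairable:
  assumes "stable C"
  shows "repairable C"
proof -
  have "\<exists>g\<in>E - C. stable (insert g C)" if "\<not> E \<subseteq> C"
  proof -
    \<comment> \<open>By minimality every proper ancestor of \<open>g\<close> is colored, so no edge
      left uncolored gains an alive child.\<close>
    obtain g where g: "g \<in> E - C" and least: "\<And>e. e \<in> E - C \<Longrightarrow> rank g \<le> rank e"
      using \<open>\<not> E \<subseteq> C\<close> ex_has_least_nat[of "\<lambda>e. e \<in> E - C" _ rank] by blast
    have "alive_children (insert g C) e = alive_children C e" if "e \<in> E - insert g C" for e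
    proof -
      have "(f, g) \<notin> child\<^sup>*" if "(e, f) \<in> child" for f
        using child_rank_less[OF that] descendant_rank_le[of f g] least[of e] \<open>e \<in> _\<close> by auto
      then show ?thesis
        by (auto simp: alive_children_def alive_insert)
    qed
    then have "stable (insert g C)"
      using assms by (simp add: stable_def)
    with g show ?thesis by blast
  qed
  moreover have "card (alive_children C e) \<le> 2" if "e \<in> E - C" for e
    using assms that unfolding stable_def by (meson le_trans one_le_numeral)
  ultimately show ?thesis
    by (auto simp: repairable_def)
qed

text \<open>The effect of a Breaker move \<open>g\<close>: at most one uncolored edge violates
  \<open>stable\<close>, and coloring that edge restores it.\<close>

lemma stable_imp_repairable_insert:
  assumes stable: "stable C"
  shows "repairable (insert g C)"
proof -
  let ?D = "insert g C"
  define towards where "towards e = {f. (e, f) \<in> child \<and> (f, g) \<in> child\<^sup>*}" for e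
  have alive_Un: "alive_children ?D e = alive_children C e \<union> towards e" for e
    by (auto simp: alive_children_def alive_insert towards_def)
  have fin_towards: "finite (towards e)" for e
    using alive_Un[of e] by (metis finite_Un finite_alive_children)
  have card_towards: "card (towards e) \<le> 1" for e
    using child_towards_unique[of e _ _ g] card_le_Suc0_iff_eq[OF fin_towards[of e]]
    by (auto simp: towards_def)
  have old: "card (alive_children C e) \<le> 1" if "e \<in> E - ?D" for e
    using stable that by (simp add: stable_def)
  have le2: "card (alive_children ?D e) \<le> 2" if "e \<in> E - ?D" for e
    using card_Un_le[of "alive_children C e" "towards e"] old[OF that] card_towards[of e]
    unfolding alive_Un by linarith
  define bad where "bad e \<longleftrightarrow> e \<in> E - ?D \<and> \<not> card (alive_children ?D e) \<le> 1" for e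
  \<comment> \<open>The only alive child that \<open>e\<close> can gain is the one towards
    \<open>g\<close>. So a bad \<open>e\<close> had an alive child before, and its child towards
    \<open>g\<close> was not alive: the newly alive path joins the alive part at
    \<open>e\<close>.\<close>
  have bad: "e \<in> alive C \<and> (e, g) \<in> child\<^sup>* \<and> (\<forall>f\<in>towards e. f \<notin> alive C)" if "bad e" for e
  proof -
    have "alive_children C e \<noteq> {}"
      using that card_towards[of e] by (auto simp: bad_def alive_Un)
    then have "e \<in> alive C"
      by (auto simp: alive_children_def intro: alive_ancestor)
    have "alive_children ?D e \<noteq> alive_children C e"
      using that old[of e] by (auto simp: bad_def)
    then obtain f where f: "f \<in> towards e" "f \<notin> alive_children C e"
      unfolding alive_Un by blast
    then have ef: "(e, f) \<in> child" "(f, g) \<in> child\<^sup>*" and f_dead: "f \<notin> alive C"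
      unfolding towards_def alive_children_def by blast+
    have "f' = f" if "f' \<in> towards e" for f'
      using that ef child_towards_unique[of e f' f g] unfolding towards_def by blast
    then have "\<forall>f'\<in>towards e. f' \<notin> alive C"
      using f_dead by metis
    moreover have "(e, g) \<in> child\<^sup>*"
      using ef by (rule converse_rtrancl_into_rtrancl)
    ultimately show ?thesis
      using \<open>e \<in> alive C\<close> by simp
  qed
  \<comment> \<open>If \<open>e\<close> were a proper ancestor of \<open>e'\<close>, its child
    towards \<open>g\<close> would be \<open>e'\<close> or an ancestor of it, hence already alive,
    contradicting \<open>bad\<close>.\<close>
  have bad_le: "e = e'" if "bad e" "bad e'" "(e, e') \<in> child\<^sup>*" for e e'
    using that(3)
  proof (cases rule: converse_rtranclE)
    case (step f)
    then have "f \<in> towards e" "f \<in> alive C"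
      using bad[OF \<open>bad e'\<close>] by (auto simp: towards_def intro: alive_ancestor)
    then show ?thesis
      using bad[OF \<open>bad e\<close>] by blast
  qed
  have bad_unique: "e = e'" if "bad e" "bad e'" for e e'
    using that bad bad_le ancestors_comparable by metis
  show ?thesis
  proof (cases "\<exists>e. bad e")
    case True
    then obtain e where e: "bad e" by blast
    \<comment> \<open>The edge \<open>e\<close> is alive already, so coloring it adds no alive
      children anywhere, and it was the only bad edge.\<close>
    then have "alive (insert e ?D) = alive ?D"
      using bad alive_insert_alive[of e ?D] by (auto simp: alive_insert)
    then have "stable (insert e ?D)"
      using e bad_unique by (auto simp: stable_def alive_children_def bad_def)
    then show ?thesis
      using e le2 by (auto simp: repairable_def bad_def)
  next
    case False
    then have "stable ?D"
      by (auto simp: stable_def bad_def)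
    then show ?thesis
      by (rule stable_imp_repairable)
  qed
qed

lemma repairable_card_adjacent:
  assumes "repairable C" "C \<subseteq> E" "e \<in> E - C" and degree: "\<And>v. v \<in> \<Union>E \<Longrightarrow> degree E v \<le> D"
  shows "card {f \<in> C. e \<inter> f \<noteq> {}} < D + 2"
proof -
  obtain v where v: "e = {low e, v}"
    using assms low_in[of e] card_edge[of e]
    by (metis DiffD1 card_2_iff insert_commute insertE singletonD)
  then have e: "e \<in> E" "v \<in> e"
    using assms(3) by blast+
  let ?U = "{f \<in> E. v \<in> f}"
  \<comment> \<open>A colored neighbour at \<open>low e\<close> is a child of \<open>e\<close>,
    alive because colored; any other contains \<open>v\<close>.\<close>
  have "{f \<in> C. e \<inter> f \<noteq> {}} \<subseteq> alive_children C e \<union> (?U - {e})"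
  proof
    fix f assume "f \<in> {f \<in> C. e \<inter> f \<noteq> {}}"
    then obtain x where f: "f \<in> C" and x: "x \<in> e" "x \<in> f" by blast
    have "x = low e \<or> x = v"
      using x(1) by (subst (asm) v) simp
    with x have "low e \<in> f \<or> v \<in> f" by blast
    moreover have "f \<in> E" "f \<noteq> e" using f assms by auto
    moreover have "f \<in> alive C"
      unfolding alive_def using f by blast
    ultimately show "f \<in> alive_children C e \<union> (?U - {e})"
      unfolding alive_children_def child_def using e(1) by blast
  qed
  then have "card {f \<in> C. e \<inter> f \<noteq> {}} \<le> card (alive_children C e \<union> (?U - {e}))"
    by (intro card_mono) (use finite_E in auto)
  also have "\<dots> \<le> card (alive_children C e) + card (?U - {e})"
    by (rule card_Un_le)
  \<comment> \<open>The edge \<open>e\<close> itself lies in \<open>?U\<close>; leaving it out makes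
    the bound strict.\<close>
  also have "\<dots> < card (alive_children C e) + card ?U"
    using e finite_E card_Diff1_less[of ?U e] by simp
  also have "\<dots> \<le> 2 + D"
  proof (rule add_mono)
    show "card (alive_children C e) \<le> 2"
      using assms(1,3) by (simp add: repairable_def)
    have "v \<in> \<Union>E" using e by blast
    then show "card ?U \<le> D"
      using degree by (simp add: degree_def)
  qed
  finally show ?thesis by simp
qed

section \<open>Maker's strategy\<close>

text \<open>No edge is colored twice, so there are as many moves meeting \<open>e\<close> as colored
  edges meeting \<open>e\<close>; being fewer than \<open>D + 2\<close>, they cannot block all
  colors.\<close>

lemma repairable_ex_legal_move:
  assumes play: "is_play E {..<D + 2} h" and rep: "repairable (fst ` set h)"
    and e: "e \<in> E - fst ` set h" and degree: "\<And>v. v \<in> \<Union>E \<Longrightarrow> degree E v \<le> D"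
  shows "\<exists>x. legal_move E {..<D + 2} h (e, x)"
proof -
  let ?C = "fst ` set h"
  let ?H = "{mv \<in> set h. e \<inter> fst mv \<noteq> {}}"
  have "inj_on fst (set h)"
    using is_play_distinct[OF play] by (simp add: distinct_map)
  then have "card ?H = card (fst ` ?H)"
    by (intro card_image[symmetric]) (auto simp: inj_on_def)
  also have "fst ` ?H = {f \<in> ?C. e \<inter> f \<noteq> {}}" by auto
  also have "card \<dots> < D + 2"
    using repairable_card_adjacent[OF rep is_play_edges[OF play] e degree] .
  finally have "card (snd ` ?H) < D + 2"
    using card_image_le[of ?H snd] by simp
  then have "\<not> {..<D + 2} \<subseteq> snd ` ?H"
    using card_mono[of "snd ` ?H" "{..<D + 2}"] by auto
  then obtain x where "x \<in> {..<D + 2}" "x \<notin> snd ` ?H" by blast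
  then have "legal_move E {..<D + 2} h (e, x)"
    using e by (force simp: legal_move_def)
  then show ?thesis ..
qed

lemma ex_maker_winning_strategy_degree:
  assumes degree: "\<And>v. v \<in> \<Union>E \<Longrightarrow> degree E v \<le> D" and m: "m \<ge> 1"
  shows "\<exists>\<sigma>. maker_winning_strategy E {..<D + 2} m \<sigma>"
proof -
  let ?X = "{..<D + 2}"
  let ?C = "\<lambda>h. fst ` set h"
  define good where "good h mv \<longleftrightarrow> legal_move E ?X h mv \<and> stable (insert (fst mv) (?C h))" for h mv
  \<comment> \<open>\<open>maker_strategy\<close> asks for legal moves in every play, also in those
    not following \<open>\<sigma>\<close>; hence the fallback when no good move exists.\<close>
  define \<sigma> where
    "\<sigma> h = (SOME mv. if \<exists>mv. good h mv then good h mv else legal_move E ?X h mv)" for h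
  have \<sigma>_good: "good h (\<sigma> h)" if "\<exists>mv. good h mv" for h
    using that unfolding \<sigma>_def by (simp add: someI_ex)
  have "legal_move E ?X h (\<sigma> h)" if "\<exists>mv. legal_move E ?X h mv" for h
  proof (cases "\<exists>mv. good h mv")
    case True
    then show ?thesis using \<sigma>_good good_def by blast
  next
    case False
    then show ?thesis using that unfolding \<sigma>_def by (simp add: someI_ex)
  qed
  then have strategy: "maker_strategy E ?X m \<sigma>"
    by (simp add: maker_strategy_def)
  have invariant: "repairable (?C h) \<and> (\<not> maker_to_move m (length h) \<longrightarrow> stable (?C h))"
    if "is_play E ?X h" "follows m \<sigma> h" for h
    using that
  proof (induction h rule: rev_induct)
    case Nil
    show ?case
      using stable_empty stable_imp_repairable by simp
  next
    case (snoc mv h)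
    have legal: "legal_move E ?X h mv"
      using snoc.prems(1) by (auto simp: is_play_def dest!: spec[of _ "length h"])
    have play: "is_play E ?X h"
      unfolding is_play_def
    proof (intro allI impI)
      fix i assume "i < length h"
      then show "legal_move E ?X (take i h) (h ! i)"
        using snoc.prems(1) by (auto simp: is_play_def nth_append dest!: spec[of _ i])
    qed
    have "follows m \<sigma> h"
      unfolding follows_def
    proof (intro allI impI)
      fix i assume "i < length h" "maker_to_move m i"
      then show "h ! i = \<sigma> (take i h)"
        using snoc.prems(2) by (auto simp: follows_def nth_append dest!: spec[of _ i])
    qed
    with play have IH: "repairable (?C h)" "\<not> maker_to_move m (length h) \<Longrightarrow> stable (?C h)"
      using snoc.IH by auto
    show ?case
    proof (cases "maker_to_move m (length h)")
      case True
      then have mv: "mv = \<sigma> h"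
        using snoc.prems(2) by (auto simp: follows_def dest!: spec[of _ "length h"])
      have "\<not> E \<subseteq> ?C h"
        using legal by (auto simp: legal_move_def)
      \<comment> \<open>This edge only shows that a good move exists; \<open>\<sigma>\<close> may
        choose another one.\<close>
      then obtain e where e: "e \<in> E - ?C h" "stable (insert e (?C h))"
        using IH(1) by (auto simp: repairable_def)
      then obtain x where "legal_move E ?X h (e, x)"
        using repairable_ex_legal_move[OF play IH(1) e(1) degree] by blast
      then have "good h (e, x)"
        using e by (simp add: good_def)
      then have "good h mv"
        using \<sigma>_good mv by blast
      then have "stable (?C (h @ [mv]))"
        by (simp add: good_def)
      then show ?thesis
        using stable_imp_repairable by blast
    next
      case False
      moreover have "length h mod (m + 1) < m + 1"
        by simp
      ultimately have "length h mod (m + 1) = m"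
        unfolding maker_to_move_def by linarith
      \<comment> \<open>Breaker's move ends the round and \<open>m \<ge> 1\<close> makes Maker next,
        so the \<open>stable\<close> clause of the invariant is vacuous here.\<close>
      then have "maker_to_move m (length (h @ [mv]))"
        using m by (simp add: maker_to_move_def mod_Suc)
      moreover have "repairable (?C (h @ [mv]))"
        using stable_imp_repairable_insert[OF IH(2)[OF False]] by simp
      ultimately show ?thesis by blast
    qed
  qed
  have "\<not> breaker_has_won E ?X h" if h: "is_play E ?X h" "follows m \<sigma> h" for h
  proof
    assume won: "breaker_has_won E ?X h"
    then obtain e where "e \<in> E - ?C h"
      by (auto simp: breaker_has_won_def all_colored_def)
    then have "\<exists>x. legal_move E ?X h (e, x)"
      using repairable_ex_legal_move[OF h(1) _ _ degree] invariant[OF h] by blast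
    with won show False
      by (auto simp: breaker_has_won_def)
  qed
  with strategy show ?thesis
    by (auto simp: maker_winning_strategy_def)
qed

end

theorem theorem2p1:
  fixes V :: "'a set" and E :: "'a set set" and m :: nat
  assumes "finite_tree V E"
    and "m \<ge> 1"
  shows "game_chromatic_index E m \<le> max_degree V E + 2"
proof -
  have V: "finite V" and E: "\<And>e. e \<in> E \<Longrightarrow> e \<subseteq> V \<and> card e = 2" and acyclic: "\<nexists>vs. is_cycle E vs"
    using assms by (auto simp: finite_tree_def finite_simple_graph_def)
  have "finite E"
    using V E by (meson Pow_iff finite_Pow_iff finite_subset subsetI)
  then obtain low rank where "ranked_edges E low rank"
    using acyclic_ex_ranking E acyclic by metis
  then interpret ranked_edges E low rank .
  have "degree E v \<le> max_degree V E" if "v \<in> \<Union>E" for v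
  proof -
    have "v \<in> V" using that E by blast
    then show ?thesis using V by (simp add: max_degree_def)
  qed
  then have "\<exists>\<sigma>. maker_winning_strategy E {..<max_degree V E + 2} m \<sigma>"
    using assms(2) by (rule ex_maker_winning_strategy_degree)
  then show ?thesis
    unfolding game_chromatic_index_def by (rule Least_le)
qed

end
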